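(* Let $k,s$ be integers with $k\ge 2$ and $s\ge 3$. Then $\operatorname{R}_k(\mathcal{B}\,|\,M_2)=k+2$ and $k+2\le \operatorname{R}_k(\mathcal{B}\,|\,M_s)\le\max\{k+7,s\}$.
   Context: $B_n$ denotes the Boolean lattice of all subsets of $[n]=\{1,\dots,n\}$ ordered by inclusion. The $s$-matching $M_s$ is the poset on $\{x_1,\dots,x_s,y_1,\dots,y_s\}$ in which $x_i\le y_i$ for all $i$ and all other pairs of distinct elements are incomparable. A copy of a poset $P$ in $B_n$ is an injection $f:P\to B_n$ with $f(x)\subseteq f(y)$ whenever $x\le y$ in $P$. $\operatorname{R}_k(\mathcal{B}\,|\,P)$ is the smallest integer $n$ such that for every assignment of one of $k$ colors to each element of $B_n$ there is a copy of $P$ in $B_n$ whose image elements all have the same color. *)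

theory Defs
  imports Main
begin

definition boolean_lattice :: "nat \<Rightarrow> nat set set" where
  "boolean_lattice n = Pow {1..n}"

text \<open>
  A poset is given by its carrier \<open>P\<close> and its (reflexive) order relation \<open>r\<close> with
  \<open>partial_order_on P r\<close>. Copies are weak: the order has to be preserved, but not reflected.
\<close>

definition is_copy :: "'a set \<Rightarrow> 'a rel \<Rightarrow> nat \<Rightarrow> ('a \<Rightarrow> nat set) \<Rightarrow> bool" where
  "is_copy P r n f \<longleftrightarrow>
     inj_on f P \<and> f ` P \<subseteq> boolean_lattice n \<and>
     (\<forall>x\<in>P. \<forall>y\<in>P. (x, y) \<in> r \<longrightarrow> f x \<subseteq> f y)"

definition forces_copy :: "nat \<Rightarrow> 'a set \<Rightarrow> 'a rel \<Rightarrow> nat \<Rightarrow> bool" where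
  "forces_copy k P r n \<longleftrightarrow>
     (\<forall>c :: nat set \<Rightarrow> nat. c ` boolean_lattice n \<subseteq> {..<k} \<longrightarrow>
       (\<exists>f i. is_copy P r n f \<and> (\<forall>x\<in>P. c (f x) = i)))"

text \<open>
  The least element is meaningful only if some \<open>n\<close> forces a copy; for matchings this is
  \<open>ex_forces_copy_matching\<close> below.
\<close>

definition boolean_ramsey :: "nat \<Rightarrow> 'a set \<Rightarrow> 'a rel \<Rightarrow> nat" where
  "boolean_ramsey k P r = (LEAST n. forces_copy k P r n)"

datatype matching_elem = Xpt nat | Ypt nat

definition matching :: "nat \<Rightarrow> matching_elem set" where
  "matching s = Xpt ` {1..s} \<union> Ypt ` {1..s}"

definition matching_order :: "nat \<Rightarrow> matching_elem rel" where
  "matching_order s = Id_on (matching s) \<union> {(Xpt i, Ypt i) | i. i \<in> {1..s}}"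

lemma partial_order_on_matching: "partial_order_on (matching s) (matching_order s)"
  by (auto simp: partial_order_on_def preorder_on_def refl_on_def trans_def antisym_def
      matching_def matching_order_def)

lemma ex_forces_copy_matching: "\<exists>n. forces_copy k (matching s) (matching_order s) n"
proof -
  define m where "m = 2 * s"
  define g where "g p = (case p of Xpt i \<Rightarrow> 2 * i - 2 | Ypt i \<Rightarrow> 2 * i - 1)" for p
  have g_simps: "g (Xpt (Suc j)) = 2 * j" "g (Ypt (Suc j)) = Suc (2 * j)" for j
    by (simp_all add: g_def)
  have g_inj: "inj_on g (matching s)"
  proof (rule inj_on_inverseI)
    fix p
    assume "p \<in> matching s"
    then obtain j where "p = Xpt (Suc j) \<or> p = Ypt (Suc j)"
      unfolding matching_def by (metis UnE atLeastAtMost_iff imageE not0_implies_Suc not_one_le_zero)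
    then show "(if even (g p) then Xpt (Suc (g p div 2)) else Ypt (Suc (g p div 2))) = p"
      by (elim disjE) (simp_all add: g_simps)
  qed
  have g_less: "g p < m" if "p \<in> matching s" for p
    using that by (auto simp: matching_def g_def m_def)
  have g_mono: "g p \<le> g q" if "(p, q) \<in> matching_order s" for p q
    using that by (auto simp: matching_order_def g_def)
  have "forces_copy k (matching s) (matching_order s) (k * m)"
    unfolding forces_copy_def
  proof (intro allI impI)
    fix c :: "nat set \<Rightarrow> nat"
    assume c: "c ` boolean_lattice (k * m) \<subseteq> {..<k}"
    define J where "J i = {j. j \<le> k * m \<and> c {1..j} = i}" for i
    have fin: "finite (J i)" for i
      by (simp add: J_def)
    have "\<exists>i. m \<le> card (J i)"
    proof (rule ccontr)
      assume "\<not> ?thesis"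
      then have less: "card (J i) \<le> m" for i
        by (simp add: not_le less_imp_le)
      have "c {1..j} < k" if "j \<le> k * m" for j
        using c that by (auto simp: boolean_lattice_def image_subset_iff)
      then have "{..k * m} = (\<Union>i<k. J i)"
        by (auto simp: J_def)
      then have "Suc (k * m) = card (\<Union>i<k. J i)"
        by (metis card_atMost)
      also have "\<dots> \<le> (\<Sum>i<k. card (J i))"
        by (rule card_UN_le) simp
      also have "\<dots> \<le> (\<Sum>i<k. m)"
        by (rule sum_mono) (rule less)
      finally show False
        by simp
    qed
    then obtain i where i: "m \<le> card (J i)" ..
    define l where "l = sorted_list_of_set (J i)"
    have l: "sorted l" "distinct l" "length l = card (J i)" "set l = J i"
      using fin by (simp_all add: l_def)
    define f where "f p = {1..l ! g p}" for p
    have idx: "g p < length l" "l ! g p \<in> J i" if "p \<in> matching s" for p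
    proof -
      show "g p < length l"
        using g_less[OF that] i l(3) by simp
      then show "l ! g p \<in> J i"
        using l(4) nth_mem[of "g p" l] by simp
    qed
    have "inj_on f (matching s)"
    proof (rule inj_onI)
      fix p q
      assume pq: "p \<in> matching s" "q \<in> matching s" "f p = f q"
      then have "card (f p) = card (f q)"
        by simp
      then have "l ! g p = l ! g q"
        by (simp add: f_def)
      then have "g p = g q"
        using idx(1)[OF pq(1)] idx(1)[OF pq(2)] l(2) by (simp add: nth_eq_iff_index_eq)
      then show "p = q"
        using g_inj pq by (auto dest: inj_onD)
    qed
    moreover have "f ` matching s \<subseteq> boolean_lattice (k * m)"
    proof (rule image_subsetI)
      fix p
      assume "p \<in> matching s"
      then have "l ! g p \<le> k * m"
        using idx(2)[of p] by (simp add: J_def)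
      then show "f p \<in> boolean_lattice (k * m)"
        by (simp add: f_def boolean_lattice_def)
    qed
    moreover have "f p \<subseteq> f q"
      if "p \<in> matching s" "q \<in> matching s" "(p, q) \<in> matching_order s" for p q
    proof -
      have "l ! g p \<le> l ! g q"
        using sorted_nth_mono[OF l(1) g_mono[OF that(3)] idx(1)[OF that(2)]] .
      then show ?thesis
        by (simp add: f_def)
    qed
    moreover have "c (f p) = i" if "p \<in> matching s" for p
      using idx(2)[OF that] by (simp add: f_def J_def)
    ultimately have "is_copy (matching s) (matching_order s) (k * m) f \<and>
        (\<forall>x\<in>matching s. c (f x) = i)"
      by (simp add: is_copy_def)
    then show "\<exists>f i. is_copy (matching s) (matching_order s) (k * m) f \<and>
        (\<forall>x\<in>matching s. c (f x) = i)"
      by (intro exI)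
  qed
  then show ?thesis ..
qed

end

theory Submission
  imports Defs Complex_Main
begin

text \<open>
  Lower bound: colour a set \<open>A\<close> by \<open>\<bar>A\<bar> - 1\<close>, truncated to \<open>{0..k-1}\<close>. For \<open>n \<le> k + 1\<close> a
  monochromatic strict inclusion then uses \<open>\<emptyset>\<close> or the full set, so two of them of the same colour
  meet.

  Upper bounds: by pigeonhole it suffices to find more than \<open>k(s-1)\<close> pairwise disjoint
  monochromatic strict inclusions, and every chain of \<open>k + 1\<close> sets contains one. For \<open>s = 2\<close> and
  \<open>n = k + 2\<close>, the proper nonempty cyclic intervals of \<open>[n]\<close> split into \<open>n\<close> disjoint chains of
  \<open>k + 1\<close> sets, according to their starting points. For \<open>n \<ge> max(k + 7, s)\<close> the inclusions are
  chosen greedily in the levels \<open>3, \<dots>, n - 3\<close>: the at most \<open>2k(s-1)\<close> sets used before are fewer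
  than \<open>n choose 3\<close>, hence their LYM weight is below 1 and some full chain avoids all of them.
\<close>

section \<open>Disjoint monochromatic inclusions and matchings\<close>

text \<open>Different pairs may have different colours. Strictness within a pair and disjointness
  between pairs make all \<open>2 * m\<close> sets distinct.\<close>

definition mono_pairs ::
    "nat \<Rightarrow> (nat set \<Rightarrow> nat) \<Rightarrow> nat \<Rightarrow> (nat \<Rightarrow> nat set) \<Rightarrow> (nat \<Rightarrow> nat set) \<Rightarrow> bool" where
  "mono_pairs n c m a b \<longleftrightarrow>
     (\<forall>i<m. a i \<subset> b i \<and> b i \<subseteq> {1..n} \<and> c (a i) = c (b i)) \<and>
     (\<forall>i<m. \<forall>j<m. i \<noteq> j \<longrightarrow> {a i, b i} \<inter> {a j, b j} = {})"

lemma repeated_value: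
  fixes g :: "nat \<Rightarrow> nat"
  assumes "g ` J \<subseteq> {..<k}" "k < card J"
  shows "\<exists>u\<in>J. \<exists>v\<in>J. u < v \<and> g u = g v"
proof -
  have "card (g ` J) \<le> k"
    using card_mono[OF _ assms(1)] by simp
  then have "\<not> inj_on g J"
    using assms(2) by (intro pigeonhole) simp
  then show ?thesis
    unfolding inj_on_def by (metis linorder_neqE_nat)
qed

text \<open>If every colour had at most \<open>s - 1\<close> pairs, there would be at most
  \<open>k * (s - 1)\<close> in all. So \<open>s\<close> pairs share a colour, and they form a copy
  because inclusions across pairs are harmless for weak copies.\<close>

lemma copy_of_mono_pairs:
  assumes c: "c ` boolean_lattice n \<subseteq> {..<k}"
    and m: "k * (s - 1) < m" and ab: "mono_pairs n c m a b"
  shows "\<exists>f i. is_copy (matching s) (matching_order s) n f \<and> (\<forall>x\<in>matching s. c (f x) = i)"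
proof -
  define J where "J t = {i. i < m \<and> c (a i) = t}" for t
  have sub: "a i \<subset> b i" "b i \<subseteq> {1..n}" "c (a i) = c (b i)" if "i < m" for i
    using ab that by (auto simp: mono_pairs_def)
  have disj: "{a i, b i} \<inter> {a j, b j} = {}" if "i < m" "j < m" "i \<noteq> j" for i j
    using ab that unfolding mono_pairs_def by blast
  have "\<exists>t. s \<le> card (J t)"
  proof (rule ccontr)
    assume "\<not> ?thesis"
    then have less: "card (J t) \<le> s - 1" for t
      by (metis Suc_pred' bot_nat_0.not_eq_extremum le0 less_Suc_eq_le not_le_imp_less)
    have "c (a i) < k" if "i < m" for i
    proof -
      have "a i \<in> boolean_lattice n"
        using sub(1,2)[OF that] by (auto simp: boolean_lattice_def)
      then show ?thesis
        using c by blast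
    qed
    then have "{..<m} = (\<Union>t<k. J t)"
      by (auto simp: J_def)
    then have "m = card (\<Union>t<k. J t)"
      by (metis card_lessThan)
    also have "\<dots> \<le> (\<Sum>t<k. card (J t))"
      by (rule card_UN_le) simp
    also have "\<dots> \<le> (\<Sum>t<k. s - 1)"
      by (rule sum_mono) (rule less)
    finally show False
      using m by simp
  qed
  then obtain t where "card {1..s} \<le> card (J t)"
    by auto
  moreover have "finite (J t)"
    by (simp add: J_def)
  ultimately obtain h where h: "h ` {1..s} \<subseteq> J t" "inj_on h {1..s}"
    using card_le_inj[of "{1..s}" "J t"] by auto
  define f where "f p = (case p of Xpt i \<Rightarrow> a (h i) | Ypt i \<Rightarrow> b (h i))" for p
  have f: "f (Xpt i) = a (h i)" "f (Ypt i) = b (h i)" for i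
    by (simp_all add: f_def)
  have hm: "h i < m" "c (a (h i)) = t" if "i \<in> {1..s}" for i
    using subsetD[OF h(1) imageI[OF that]] by (simp_all add: J_def)
  have hne: "h i \<noteq> h j" if "i \<in> {1..s}" "j \<in> {1..s}" "i \<noteq> j" for i j
    using h(2) that by (auto dest: inj_onD)
  have hd: "{a (h i), b (h i)} \<inter> {a (h j), b (h j)} = {}"
    if "i \<in> {1..s}" "j \<in> {1..s}" "i \<noteq> j" for i j
    using disj[OF hm(1)[OF that(1)] hm(1)[OF that(2)] hne[OF that]] .
  have ne: "a (h i) \<noteq> b (h i)" if "i \<in> {1..s}" for i
    using sub(1)[OF hm(1)[OF that]] by blast
  have inj: "inj_on f (matching s)"
  proof (rule inj_onI)
    fix p q
    assume "p \<in> matching s" "q \<in> matching s" and eq: "f p = f q"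
    then obtain i j where ij: "i \<in> {1..s}" "p = Xpt i \<or> p = Ypt i"
        "j \<in> {1..s}" "q = Xpt j \<or> q = Ypt j"
      by (auto simp: matching_def)
    have "i = j"
    proof (rule ccontr)
      assume "i \<noteq> j"
      from hd[OF ij(1,3) this] show False
        using ij(2,4) eq by (auto simp: f)
    qed
    then show "p = q"
      using ij(2,4) eq ne[OF ij(1)] by (auto simp: f)
  qed
  have "is_copy (matching s) (matching_order s) n f"
    unfolding is_copy_def
  proof (intro conjI ballI impI)
    show "f ` matching s \<subseteq> boolean_lattice n"
    proof (rule image_subsetI)
      fix p assume "p \<in> matching s"
      then obtain i where i: "i \<in> {1..s}" "p = Xpt i \<or> p = Ypt i"
        by (auto simp: matching_def)
      then show "f p \<in> boolean_lattice n"
        using sub(1,2)[OF hm(1)[OF i(1)]] by (auto simp: f boolean_lattice_def)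
    qed
  next
    fix p q assume "(p, q) \<in> matching_order s"
    then consider "p = q" | i where "i \<in> {1..s}" "p = Xpt i" "q = Ypt i"
      by (auto simp: matching_order_def)
    then show "f p \<subseteq> f q"
      by cases (use sub(1)[OF hm(1)] in \<open>auto simp: f\<close>)
  qed (rule inj)
  moreover have "\<forall>x\<in>matching s. c (f x) = t"
    using hm sub(3) by (auto simp: matching_def f)
  ultimately show ?thesis
    by blast
qed

section \<open>Lower bound from a colouring by cardinality\<close>

lemma forces_copy_matching_lower:
  assumes k: "2 \<le> k" and s: "2 \<le> s" and forces: "forces_copy k (matching s) (matching_order s) n"
  shows "k + 2 \<le> n"
proof (rule ccontr)
  assume "\<not> ?thesis"
  then have n: "n \<le> k + 1" by simp
  \<comment> \<open>Truncated subtraction gives sizes 0 and 1 the colour 0, and \<open>min\<close>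
    merges sizes \<open>k\<close> and \<open>k + 1\<close>; no other sizes up to
    \<open>k + 1\<close> share a colour.\<close>
  define c :: "nat set \<Rightarrow> nat" where "c A = min (card A - 1) (k - 1)" for A
  have "c ` boolean_lattice n \<subseteq> {..<k}"
    using k by (auto simp: c_def)
  then obtain f t where f: "is_copy (matching s) (matching_order s) n f"
      and col: "\<forall>x\<in>matching s. c (f x) = t"
    using forces unfolding forces_copy_def by blast
  have mem: "Xpt i \<in> matching s" "Ypt i \<in> matching s" if "i \<in> {1, 2}" for i
    using that s by (auto simp: matching_def)
  have key: "f (Xpt i) = {} \<and> t = 0 \<or> f (Ypt i) = {1..n} \<and> t = k - 1" if i: "i \<in> {1, 2}" for i
  proof -
    have "(Xpt i, Ypt i) \<in> matching_order s"
      using i s by (auto simp: matching_order_def)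
    then have "f (Xpt i) \<subseteq> f (Ypt i)" and "f (Xpt i) \<noteq> f (Ypt i)"
      and Y: "f (Ypt i) \<subseteq> {1..n}" "f (Xpt i) \<subseteq> {1..n}"
      using f mem[OF i] by (auto simp: is_copy_def boolean_lattice_def inj_on_def)
    moreover have fin: "finite (f (Ypt i))" "finite (f (Xpt i))"
      using Y finite_subset by blast+
    ultimately have lt: "card (f (Xpt i)) < card (f (Ypt i))"
      by (metis psubset_card_mono psubsetI)
    have le: "card (f (Ypt i)) \<le> n"
      using card_mono[OF _ Y(1)] by simp
    have ct: "min (card (f (Xpt i)) - 1) (k - 1) = t" "min (card (f (Ypt i)) - 1) (k - 1) = t"
      using col mem[OF i] by (auto simp: c_def)
    then have "card (f (Xpt i)) = 0 \<and> t = 0 \<or> card (f (Ypt i)) = n \<and> t = k - 1"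
      using lt le n k by (auto simp: min_def split: if_splits)
    then show ?thesis
      using card_subset_eq[OF _ Y(1)] fin by auto
  qed
  have "f (Xpt 1) \<noteq> f (Xpt 2)" "f (Ypt 1) \<noteq> f (Ypt 2)"
    using f inj_on_eq_iff[of f "matching s"] mem[of 1] mem[of 2] by (auto simp: is_copy_def)
  \<comment> \<open>Since \<open>k \<ge> 2\<close> separates the colours 0 and \<open>k - 1\<close>,
    both pairs fall under the same alternative of \<open>key\<close> and share a set.\<close>
  then show False
    using key[of 1] key[of 2] k by auto
qed

section \<open>Cyclic intervals and the 2-matching\<close>

text \<open>For \<open>i, j < n\<close>, \<open>A i j\<close> is the cyclic interval of the
  \<open>j\<close> points following \<open>i\<close>; the disjunct \<open>x + n \<le> i + j\<close>
  is the part wrapped past \<open>n\<close>. A proper nonempty interval determines its starting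
  point.\<close>

lemma cyclic_interval_chains:
  fixes n :: nat
  defines "A \<equiv> \<lambda>i j. {x \<in> {1..n}. i < x \<and> x \<le> i + j \<or> x + n \<le> i + j}"
  shows "i < n \<Longrightarrow> j < j' \<Longrightarrow> j' < n \<Longrightarrow> A i j \<subset> A i j'"
    and "i < n \<Longrightarrow> i' < n \<Longrightarrow> 0 < j \<Longrightarrow> 0 < j' \<Longrightarrow> j < n \<Longrightarrow> j' < n \<Longrightarrow> i \<noteq> i' \<Longrightarrow> A i j \<noteq> A i' j'"
proof -
  assume i: "i < n" and jj: "j < j'" "j' < n"
  have "A i j \<subseteq> A i j'"
    using jj by (auto simp: A_def)
  \<comment> \<open>The witness is the point following \<open>A i j\<close> cyclically.\<close>
  moreover have "i + j + 1 \<in> A i j' - A i j" if "i + j + 1 \<le> n"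
    using that jj i by (auto simp: A_def)
  moreover have "i + j + 1 - n \<in> A i j' - A i j" if "\<not> i + j + 1 \<le> n"
    using that jj i by (auto simp: A_def)
  ultimately show "A i j \<subset> A i j'"
    by blast
next
  have *: "A i j \<noteq> A i' j'" if "i < i'" "i' < n" "0 < j'" "j < n" "j' < n" for i i' j j'
  proof -
    \<comment> \<open>As \<open>i < i'\<close>, the point \<open>i'\<close> lies in the ground set.
      \<open>A i' j'\<close> starts right after it, whereas \<open>A i j\<close> starts earlier and
      cannot contain \<open>i' + 1\<close> without \<open>i'\<close>.\<close>
    have "i' \<notin> A i' j'" "i' + 1 \<in> A i' j'" "i' + 1 \<in> A i j \<Longrightarrow> i' \<in> A i j"
      using that by (auto simp: A_def)
    then show ?thesis by blast
  qed
  assume "i < n" "i' < n" "0 < j" "0 < j'" "j < n" "j' < n" "i \<noteq> i'"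
  then show "A i j \<noteq> A i' j'"
    using *[of i i' j' j] *[of i' i j j'] by (metis linorder_neqE_nat)
qed

lemma forces_copy_matching_2: "forces_copy k (matching 2) (matching_order 2) (k + 2)"
  unfolding forces_copy_def
proof (intro allI impI)
  fix c :: "nat set \<Rightarrow> nat"
  assume c: "c ` boolean_lattice (k + 2) \<subseteq> {..<k}"
  define n where "n = k + 2"
  define A where "A = (\<lambda>i j. {x \<in> {1..n}. i < x \<and> x \<le> i + j \<or> x + n \<le> i + j})"
  have A_in: "A i j \<subseteq> {1..n}" for i j
    by (auto simp: A_def)
  have psub: "A i j \<subset> A i j'" if "i < n" "j < j'" "j' < n" for i j j'
    unfolding A_def using that by (rule cyclic_interval_chains(1))
  have neq: "A i j \<noteq> A i' j'"
    if "i < n" "i' < n" "0 < j" "0 < j'" "j < n" "j' < n" "i \<noteq> i'" for i i' j j'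
    unfolding A_def using that by (rule cyclic_interval_chains(2))
  have "\<exists>u v. 0 < u \<and> u < v \<and> v < n \<and> c (A i u) = c (A i v)" for i
  proof -
    have "(\<lambda>j. c (A i j)) ` {1..k + 1} \<subseteq> {..<k}"
    proof (rule image_subsetI)
      fix j
      have "A i j \<in> boolean_lattice (k + 2)"
        using A_in[of i j] by (simp add: boolean_lattice_def n_def)
      then show "c (A i j) \<in> {..<k}"
        using c by blast
    qed
    then obtain u v where "u \<in> {1..k + 1}" "v \<in> {1..k + 1}" "u < v" "c (A i u) = c (A i v)"
      using repeated_value[of "\<lambda>j. c (A i j)" "{1..k + 1}" k] by auto
    then show ?thesis
      by (intro exI[of _ u] exI[of _ v]) (auto simp: n_def)
  qed
  then obtain u v where uv: "\<And>i. 0 < u i" "\<And>i. u i < v i" "\<And>i. v i < n"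
      "\<And>i. c (A i (u i)) = c (A i (v i))"
    by metis
  have v0: "0 < v i" and un: "u i < n" for i
    using uv(1-3)[of i] by auto
  have "mono_pairs n c n (\<lambda>i. A i (u i)) (\<lambda>i. A i (v i))"
    unfolding mono_pairs_def
  proof (intro conjI allI impI)
    fix i assume "i < n"
    then show "A i (u i) \<subset> A i (v i)"
      using uv(2,3) by (rule psub)
  next
    fix i j assume "i < n" "j < n" "i \<noteq> j"
    then show "{A i (u i), A i (v i)} \<inter> {A j (u j), A j (v j)} = {}"
      using neq[of i j] uv(1,3) v0 un by simp
  qed (rule A_in uv(4))+
  then show "\<exists>f i. is_copy (matching 2) (matching_order 2) (k + 2) f
      \<and> (\<forall>x\<in>matching 2. c (f x) = i)"
    using copy_of_mono_pairs[OF c, of 2 n] by (simp add: n_def)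
qed

section \<open>Full chains avoiding a family of small LYM weight\<close>

text \<open>A random full chain passes through \<open>A\<close> with probability
  \<open>1 / (card S choose card A)\<close>, so a total below 1 leaves a chain that misses
  \<open>X\<close>. The induction replaces probability by averaging over the coatoms
  \<open>S - {x}\<close>.\<close>

lemma full_chain_avoiding:
  assumes "finite S" "X \<subseteq> Pow S" "(\<Sum>A\<in>X. 1 / real (card S choose card A)) < 1"
  shows "\<exists>f. \<forall>i\<le>card S. f i \<subseteq> S \<and> card (f i) = i \<and> f i \<notin> X \<and> (\<forall>j\<le>i. f j \<subseteq> f i)"
  using assms
proof (induction "card S" arbitrary: S X)
  case 0
  then have "{} \<notin> X"
    by (auto simp: subset_singleton_iff)
  then show ?case
    using 0 by (intro exI[of _ "\<lambda>_. {}"]) auto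
next
  case (Suc n)
  have finX: "finite X"
    using Suc.prems finite_subset by blast
  have cardA: "card A \<le> Suc n" "finite A" if "A \<in> X" for A
    using Suc.prems(1,2) Suc.hyps(2) that card_mono[of S A] finite_subset[of A S] by auto
  \<comment> \<open>The set \<open>S\<close> alone would have weight 1. Its absence keeps the
    binomials \<open>n choose card A\<close> nonzero and lets \<open>S\<close> top the
    chain.\<close>
  have S: "S \<notin> X"
  proof
    assume "S \<in> X"
    then have "1 / real (card S choose card S) \<le> (\<Sum>A\<in>X. 1 / real (card S choose card A))"
      by (intro member_le_sum finX) auto
    then show False
      using Suc.prems(3) by simp
  qed
  define w where "w x = (\<Sum>A\<in>{A\<in>X. x \<notin> A}. 1 / real (n choose card A))" for x
  text \<open>The weight is the average of the weights in the Boolean lattices below the coatoms.\<close>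
  have "(\<Sum>x\<in>S. w x) = (\<Sum>A\<in>X. \<Sum>x | x \<in> S \<and> x \<notin> A. 1 / real (n choose card A))"
    unfolding w_def by (rule sum.swap_restrict[OF Suc.prems(1) finX])
  also have "\<dots> = (\<Sum>A\<in>X. real (Suc n) * (1 / real (card S choose card A)))"
  proof (rule sum.cong)
    fix A assume A: "A \<in> X"
    have "{x. x \<in> S \<and> x \<notin> A} = S - A"
      by auto
    moreover have "card (S - A) = Suc n - card A"
      using A Suc.prems(2) Suc.hyps(2) cardA by (subst card_Diff_subset) auto
    ultimately have 1: "(\<Sum>x | x \<in> S \<and> x \<notin> A. 1 / real (n choose card A))
        = real (Suc n - card A) / real (n choose card A)"
      by simp
    have "A \<noteq> S"
      using A S by blast
    then have "card A < card S"
      using A Suc.prems(1,2) by (intro psubset_card_mono) auto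
    then have le: "card A \<le> n"
      using Suc.hyps(2) by simp
    \<comment> \<open>\<open>A\<close> lies below \<open>Suc n - card A\<close> coatoms; absorption
      turns its total weight there into \<open>Suc n\<close> times its weight in
      \<open>S\<close>.\<close>
    have "(Suc n - card A) * (Suc n choose card A) = Suc n * (n choose card A)"
      using binomial_absorb_comp[of "Suc n" "card A"] by simp
    then have "real (Suc n - card A) * real (Suc n choose card A)
        = real (Suc n) * real (n choose card A)"
      by (metis of_nat_mult)
    moreover have "real (Suc n choose card A) \<noteq> 0" "real (n choose card A) \<noteq> 0"
      using le by simp_all
    ultimately have "real (Suc n - card A) / real (n choose card A)
        = real (Suc n) * (1 / real (Suc n choose card A))"
      by (simp add: divide_simps del: binomial_Suc_n)
    then show "(\<Sum>x | x \<in> S \<and> x \<notin> A. 1 / real (n choose card A))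
        = real (Suc n) * (1 / real (card S choose card A))"
      using 1 Suc.hyps(2) by simp
  qed simp
  also have "\<dots> = real (Suc n) * (\<Sum>A\<in>X. 1 / real (card S choose card A))"
    by (simp only: sum_distrib_left)
  also have "\<dots> < real (Suc n) * 1"
    using Suc.prems(3) by (intro mult_strict_left_mono) auto
  also have "\<dots> = (\<Sum>x\<in>S. 1)"
    using Suc.hyps(2) by simp
  finally obtain x where x: "x \<in> S" "w x < 1"
    using sum_mono[of S "\<lambda>_. 1" w] by (meson leI linorder_not_less)
  have card: "n = card (S - {x})"
    using x(1) Suc.hyps(2) Suc.prems(1) by simp
  have "\<exists>f. \<forall>i\<le>card (S - {x}). f i \<subseteq> S - {x} \<and> card (f i) = i \<and> f i \<notin> {A\<in>X. x \<notin> A}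
      \<and> (\<forall>j\<le>i. f j \<subseteq> f i)"
    using x Suc.prems(1,2) card w_def by (intro Suc.hyps(1)) auto
  then obtain f where f: "\<And>i. i \<le> n \<Longrightarrow> f i \<subseteq> S - {x} \<and> card (f i) = i
      \<and> f i \<notin> {A\<in>X. x \<notin> A} \<and> (\<forall>j\<le>i. f j \<subseteq> f i)"
    using card by auto
  \<comment> \<open>The sets from the induction omit \<open>x\<close>, so avoiding the members of
    \<open>X\<close> without \<open>x\<close> means avoiding all of \<open>X\<close>.\<close>
  have "(f(Suc n := S)) i \<subseteq> S \<and> card ((f(Suc n := S)) i) = i \<and> (f(Suc n := S)) i \<notin> X
      \<and> (\<forall>j\<le>i. (f(Suc n := S)) j \<subseteq> (f(Suc n := S)) i)" if "i \<le> card S" for i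
  proof (cases "i = Suc n")
    case True
    then show ?thesis
      using S Suc.hyps(2)[symmetric] f by (auto simp: le_Suc_eq; blast)
  next
    case False
    then have "i \<le> n"
      using that Suc.hyps(2) by simp
    then show ?thesis
      using f[of i] by auto
  qed
  then show ?case
    by blast
qed

lemma binomial_ge_inner:
  assumes "r \<le> j" "j + r \<le> n"
  shows "n choose r \<le> n choose j"
proof (cases "2 * j \<le> n")
  case True
  then show ?thesis
    using assms by (intro binomial_mono) auto
next
  case False
  then have "n choose r \<le> n choose (n - j)"
    using assms by (intro binomial_mono) auto
  also have "\<dots> = n choose j"
    using assms by (subst binomial_symmetric[of j]) auto
  finally show ?thesis .
qed

section \<open>Greedy choice of pairs in the middle levels\<close>

text \<open>On levels \<open>r\<close> to \<open>n - r\<close> each set weighs at most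
  \<open>1 / (n choose r)\<close>, so the forbidden ones weigh less than 1 together, and
  \<open>k + 2 * r \<le> n\<close> leaves the \<open>k + 1\<close> levels needed for a repeated
  colour.\<close>

lemma mono_pair_avoiding:
  assumes c: "c ` boolean_lattice n \<subseteq> {..<k}" and r: "k + 2 * r \<le> n"
    and X: "finite X" "card X < n choose r"
  shows "\<exists>u v. u \<subset> v \<and> v \<subseteq> {1..n} \<and> c u = c v \<and> u \<notin> X \<and> v \<notin> X"
proof -
  \<comment> \<open>Forbidden sets outside the middle levels may be heavy; they are dropped, as the
    chain is used only on levels \<open>r\<close> to \<open>r + k\<close>.\<close>
  define Y where "Y = {A \<in> X. A \<subseteq> {1..n} \<and> r \<le> card A \<and> card A + r \<le> n}"
  have Y_sub: "Y \<subseteq> Pow {1..n}"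
    by (auto simp: Y_def)
  have pos: "0 < n choose r"
    using r by simp
  have "(\<Sum>A\<in>Y. 1 / real (card {1..n} choose card A)) \<le> (\<Sum>A\<in>Y. 1 / real (n choose r))"
  proof (rule sum_mono)
    fix A assume "A \<in> Y"
    then have "n choose r \<le> n choose card A"
      by (intro binomial_ge_inner) (auto simp: Y_def)
    then show "1 / real (card {1..n} choose card A) \<le> 1 / real (n choose r)"
      using pos by (auto simp: divide_simps)
  qed
  also have "\<dots> = real (card Y) / real (n choose r)"
    by simp
  also have "\<dots> < 1"
    using X card_mono[of X Y] pos by (auto simp: Y_def divide_simps)
  finally obtain f where f: "\<And>i. i \<le> n \<Longrightarrow> f i \<subseteq> {1..n} \<and> card (f i) = i \<and> f i \<notin> Y
      \<and> (\<forall>j\<le>i. f j \<subseteq> f i)"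
    using full_chain_avoiding[of "{1..n}" Y] Y_sub by auto
  have "(\<lambda>i. c (f i)) ` {r..r + k} \<subseteq> {..<k}"
    using c f r by (auto simp: boolean_lattice_def image_subset_iff)
  then obtain i j where ij: "i \<in> {r..r + k}" "j \<in> {r..r + k}" "i < j" "c (f i) = c (f j)"
    using repeated_value[of "\<lambda>i. c (f i)" "{r..r + k}" k] by auto
  then have "i \<le> n" "j \<le> n" "i + r \<le> n" "j + r \<le> n"
    using r by auto
  note fi = f[OF \<open>i \<le> n\<close>] and fj = f[OF \<open>j \<le> n\<close>]
  have "f i \<subset> f j"
    using fi fj ij(3) by (metis nat_less_le psubsetI)
  moreover have "f i \<notin> X" "f j \<notin> X"
    using fi fj ij(1,2) \<open>i + r \<le> n\<close> \<open>j + r \<le> n\<close> by (auto simp: Y_def)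
  ultimately show ?thesis
    using fj ij(4) by blast
qed

text \<open>Before the last pair is chosen, the earlier ones occupy at most
  \<open>2 * (m - 1)\<close> sets; the bound on \<open>m\<close> says, without subtraction, that
  this is below \<open>n choose r\<close>.\<close>

lemma mono_pairs_exist:
  assumes c: "c ` boolean_lattice n \<subseteq> {..<k}" and r: "k + 2 * r \<le> n"
    and m: "2 * m < (n choose r) + 2"
  shows "\<exists>a b. mono_pairs n c m a b"
  using m
proof (induction m)
  case 0
  then show ?case
    by (simp add: mono_pairs_def)
next
  case (Suc m)
  then obtain a b where ab: "mono_pairs n c m a b"
    by auto
  have "card (a ` {..<m} \<union> b ` {..<m}) \<le> m + m"
    using card_Un_le[of "a ` {..<m}" "b ` {..<m}"] card_image_le[of "{..<m}" a]
      card_image_le[of "{..<m}" b] by simp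
  then have "card (a ` {..<m} \<union> b ` {..<m}) < n choose r"
    using Suc.prems by simp
  then obtain u v where uv: "u \<subset> v" "v \<subseteq> {1..n}" "c u = c v"
      "u \<notin> a ` {..<m} \<union> b ` {..<m}" "v \<notin> a ` {..<m} \<union> b ` {..<m}"
    using mono_pair_avoiding[OF c r, of "a ` {..<m} \<union> b ` {..<m}"] by blast
  have "mono_pairs n c (Suc m) (a(m := u)) (b(m := v))"
    using ab uv unfolding mono_pairs_def less_Suc_eq by (auto simp: image_iff)
  then show ?case
    by blast
qed

lemma choose_3_bound:
  assumes "k + 7 \<le> n" "s \<le> n"
  shows "2 * (k * (s - 1)) < n choose 3"
proof -
  have "k * (s - 1) \<le> (n - 7) * (n - 1)"
    using assms by (intro mult_le_mono) auto
  moreover obtain d where d: "n = d + 7"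
    using assms(1) by (metis add.commute le_Suc_ex le_add2 order_trans)
  have "6 * (n choose 3) = n * (n - 1) * (n - 2)"
  proof -
    have "3 * (n choose 3) = n * ((n - 1) choose 2)"
      using binomial_absorption[of 2 n] by (simp add: numeral_3_eq_3)
    then have "6 * (n choose 3) = n * (2 * ((n - 1) choose 2))"
      by simp
    also have "2 * ((n - 1) choose 2) = (n - 1) * (n - 2)"
      using binomial_absorption[of 1 "n - 1"] by (simp add: numeral_2_eq_2)
    finally show ?thesis
      by (simp add: mult.assoc)
  qed
  moreover have "12 * ((n - 7) * (n - 1)) < n * (n - 1) * (n - 2)"
  proof -
    \<comment> \<open>After cancelling \<open>n - 1\<close>, the claim is
      \<open>12 * (n - 7) < n * (n - 2)\<close>; the right side is
      \<open>d * d + 12 * d + 35\<close>.\<close>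
    have "12 * d < (d + 7) * (d + 5)"
      by (simp add: algebra_simps)
    then have "12 * d * (d + 6) < (d + 7) * (d + 5) * (d + 6)"
      by (intro mult_strict_right_mono) auto
    then show ?thesis
      by (simp add: d ac_simps)
  qed
  ultimately show ?thesis
    by linarith
qed

lemma forces_copy_matching_upper:
  assumes "k + 7 \<le> n" "s \<le> n"
  shows "forces_copy k (matching s) (matching_order s) n"
  unfolding forces_copy_def
proof (intro allI impI)
  fix c :: "nat set \<Rightarrow> nat"
  assume c: "c ` boolean_lattice n \<subseteq> {..<k}"
  \<comment> \<open>With \<open>m = k * (s - 1) + 1\<close> pairs and \<open>r = 3\<close>, the
    greedy condition becomes exactly \<open>choose_3_bound\<close>.\<close>
  obtain a b where "mono_pairs n c (Suc (k * (s - 1))) a b"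
    using mono_pairs_exist[OF c, of 3 "Suc (k * (s - 1))"] choose_3_bound[OF assms] assms(1) by auto
  then show "\<exists>f i. is_copy (matching s) (matching_order s) n f \<and> (\<forall>x\<in>matching s. c (f x) = i)"
    by (rule copy_of_mono_pairs[OF c lessI])
qed

theorem theorem3p3:
  fixes k s :: nat
  assumes "k \<ge> 2" and "s \<ge> 3"
  shows "boolean_ramsey k (matching 2) (matching_order 2) = k + 2 \<and>
         k + 2 \<le> boolean_ramsey k (matching s) (matching_order s) \<and>
         boolean_ramsey k (matching s) (matching_order s) \<le> max (k + 7) s"
proof -
  \<comment> \<open>Because some \<open>n\<close> forces a copy, the \<open>LEAST\<close> value
    itself does, so the lower bound applies to it.\<close>
  have lower: "k + 2 \<le> boolean_ramsey k (matching q) (matching_order q)" if "2 \<le> q" for q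
    unfolding boolean_ramsey_def
    using assms(1) that LeastI_ex[OF ex_forces_copy_matching] by (rule forces_copy_matching_lower)
  have upper: "boolean_ramsey k (matching q) (matching_order q) \<le> n"
    if "forces_copy k (matching q) (matching_order q) n" for q n
    unfolding boolean_ramsey_def using that by (rule Least_le)
  show ?thesis
    using lower[of 2] lower[of s] assms(2) upper[OF forces_copy_matching_2]
      upper[OF forces_copy_matching_upper[of k "max (k + 7) s" s]]
    by (auto intro: antisym)
qed

end
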